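(* Let $n\in(2,3)$ and let $u^h\in X_h$ be strictly positive with $E_h[u^h]\le c_Fh^{-(p-2)/(p+2)}$. Then $A^h_\Delta(u^h,-\Delta_hu^h)=A^h_\nabla(u^h,-\Delta_hu^h)$ and there are numbers $\sigma_i^h\in[0,1]$ such that, with $\theta_i:=\sigma_i^hu^h_i+(1-\sigma_i^h)u^h_{i+1}$, $$\begin{aligned}A^h_\Delta(u^h,-\Delta_hu^h)&=\tfrac14\tfrac{|(n-2)(n-3)|}{3}\,h\sum_{i=1}^{L_h}\theta_i^{\,n-4}\Big|\tfrac{u^h_{i+1}-u^h_i}{h}\Big|^2\Big[\Big|\tfrac{u^h_i-u^h_{i-1}}{h}\Big|^2+2\Big|\tfrac{u^h_{i+1}-u^h_i}{h}\Big|^2+\Big|\tfrac{u^h_{i+2}-u^h_{i+1}}{h}\Big|^2\Big]\\&\ge\tfrac{|(n-2)(n-3)|}{3}\,\tfrac{(1+C_{osc})^{n-4}}{2}\,h\sum_{i=1}^{L_h}(u^h_i)^{n-4}\Big(\Big|\tfrac{u^h_{i+1}-u^h_i}{h}\Big|^2\Big|\tfrac{u^h_i-u^h_{i-1}}{h}\Big|^2+\Big|\tfrac{u^h_{i+1}-u^h_i}{h}\Big|^4\Big).\end{aligned}$$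
   Context: $L>0$, $\mathcal O=(0,L)$ with periodic boundary conditions, $h>0$ with $L_h:=L/h\in\mathbb N$. $X_h$ is the space of $L$-periodic continuous functions that are linear on each $[(i-1)h,ih]$; $v_i:=v(ih)$ with periodic indices; $\mathcal I_h$ is nodal interpolation into $X_h$. $\Delta_hu^h\in X_h$ has nodal values $(u^h_{i+1}-2u^h_i+u^h_{i-1})/h^2$. $F(u)=c_Fu^{-p}$ for $u>0$, with $c_F>0$ and $p>n$; $E_h[v]:=\int_{\mathcal O}\frac12|v_x|^2+\mathcal I_h[F(v)]\,dx$; $C_{osc}:=1+\sqrt{2c_F}$. For positive $u^h\in X_h$ and $v^h\in X_h$: $A^h_\Delta(u^h,v^h)=-\frac{n-2}{6}h\sum_{i}(u^h_i)^{n-3}\big(|\frac{u^h_i-u^h_{i-1}}h|^2+|\frac{u^h_{i+1}-u^h_i}h|^2\big)v^h_i-\frac{n-2}{6}h\sum_{i}\big\{((u^h_i)^{n-3}+(u^h_{i+1})^{n-3})\frac{u^h_{i+1}-u^h_i}{h}+((u^h_{i-1})^{n-3}+(u^h_i)^{n-3})\frac{u^h_i-u^h_{i-1}}{h}\big\}\frac{u^h_{i+1}-u^h_{i-1}}{2h}v^h_i$, $A^h_\nabla(u^h,v^h)=-\frac{n-2}{12}h\sum_i\big\{((u^h_i)^{n-3}+(u^h_{i+1})^{n-3})|\frac{u^h_{i+1}-u^h_i}{h}|^2+((u^h_i)^{n-3}+(u^h_{i-1})^{n-3})|\frac{u^h_i-u^h_{i-1}}{h}|^2\big\}v^h_i-\frac{n-2}{24}h\sum_i\big((u^h_{i+1})^{n-3}+2(u^h_i)^{n-3}+(u^h_{i-1})^{n-3}\big)|\frac{u^h_{i+1}-u^h_{i-1}}{h}|^2v^h_i-\frac{n-2}{24}h\sum_i\big(2(u^h_i)^{n-3}-(u^h_{i+1})^{n-3}-(u^h_{i-1})^{n-3}\big)\big(|\frac{u^h_{i+1}-u^h_i}{h}|^2+|\frac{u^h_i-u^h_{i-1}}{h}|^2\big)v^h_i$,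 all sums over $i=1,\dots,L_h$. *)

theory Defs
  imports "HOL-Analysis.Analysis"
begin

text \<open>
  Throughout, \<open>L > 0\<close> is the period, \<open>h > 0\<close> the mesh size, and \<open>L / h\<close> is a natural number.
  Functions on the periodic interval are \<open>L\<close>-periodic functions on the whole real line, so that
  nodal values carry arbitrary integer indices and periodicity of the index is automatic.
\<close>

definition node :: "real \<Rightarrow> (real \<Rightarrow> real) \<Rightarrow> int \<Rightarrow> real" where
  "node h v i = v (real_of_int i * h)"

definition Lh :: "real \<Rightarrow> real \<Rightarrow> int" where
  "Lh L h = \<lfloor>L / h\<rfloor>"

definition Xh :: "real \<Rightarrow> real \<Rightarrow> (real \<Rightarrow> real) set" where
  "Xh L h = {v. (\<forall>x. v (x + L) = v x) \<and> continuous_on UNIV v \<and>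
     (\<forall>i::int. \<exists>a b. \<forall>x\<in>{real_of_int (i - 1) * h..real_of_int i * h}. v x = a * x + b)}"

text \<open>
  The element of \<open>Xh\<close> with prescribed nodal values; by \<open>Xh_ex1\<close> below it exists and is unique
  as soon as the prescribed values are periodic.
\<close>

definition from_nodes :: "real \<Rightarrow> real \<Rightarrow> (int \<Rightarrow> real) \<Rightarrow> real \<Rightarrow> real" where
  "from_nodes L h w = (THE v. v \<in> Xh L h \<and> (\<forall>i. node h v i = w i))"

definition Ih :: "real \<Rightarrow> real \<Rightarrow> (real \<Rightarrow> real) \<Rightarrow> real \<Rightarrow> real" where
  "Ih L h f = from_nodes L h (node h f)"

definition Laph :: "real \<Rightarrow> real \<Rightarrow> (real \<Rightarrow> real) \<Rightarrow> real \<Rightarrow> real" where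
  "Laph L h u = from_nodes L h
     (\<lambda>i. (node h u (i + 1) - 2 * node h u i + node h u (i - 1)) / h\<^sup>2)"

text \<open>Only the values at positive arguments are relevant.\<close>

definition F :: "real \<Rightarrow> real \<Rightarrow> real \<Rightarrow> real" where
  "F cF p u = cF * u powr (- p)"

text \<open>
  For \<open>v\<close> in \<open>Xh\<close> the derivative exists away from the (finitely many) nodes in \<open>{0..L}\<close>,
  so the unspecified value of \<open>deriv v\<close> there does not affect the integral.
\<close>

definition Eh :: "real \<Rightarrow> real \<Rightarrow> real \<Rightarrow> real \<Rightarrow> (real \<Rightarrow> real) \<Rightarrow> real" where
  "Eh L h cF p v =
     integral {0..L} (\<lambda>x. 1/2 * \<bar>deriv v x\<bar>\<^sup>2 + Ih L h (\<lambda>y. F cF p (v y)) x)"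

definition Cosc :: "real \<Rightarrow> real" where
  "Cosc cF = 1 + sqrt (2 * cF)"

definition dq :: "real \<Rightarrow> (real \<Rightarrow> real) \<Rightarrow> int \<Rightarrow> int \<Rightarrow> real" where
  "dq h u i j = (node h u i - node h u j) / h"

definition A_Delta ::
    "real \<Rightarrow> real \<Rightarrow> real \<Rightarrow> (real \<Rightarrow> real) \<Rightarrow> (real \<Rightarrow> real) \<Rightarrow> real" where
  "A_Delta n L h u v =
     - ((n - 2) / 6) * h * (\<Sum>i=1..Lh L h.
         node h u i powr (n - 3) * (\<bar>dq h u i (i - 1)\<bar>\<^sup>2 + \<bar>dq h u (i + 1) i\<bar>\<^sup>2) * node h v i)
     - (n - 2) / 6 * h * (\<Sum>i=1..Lh L h.
         ((node h u i powr (n - 3) + node h u (i + 1) powr (n - 3)) * dq h u (i + 1) i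
          + (node h u (i - 1) powr (n - 3) + node h u i powr (n - 3)) * dq h u i (i - 1))
         * ((node h u (i + 1) - node h u (i - 1)) / (2 * h)) * node h v i)"

definition A_nabla ::
    "real \<Rightarrow> real \<Rightarrow> real \<Rightarrow> (real \<Rightarrow> real) \<Rightarrow> (real \<Rightarrow> real) \<Rightarrow> real" where
  "A_nabla n L h u v =
     - ((n - 2) / 12) * h * (\<Sum>i=1..Lh L h.
         ((node h u i powr (n - 3) + node h u (i + 1) powr (n - 3)) * \<bar>dq h u (i + 1) i\<bar>\<^sup>2
          + (node h u i powr (n - 3) + node h u (i - 1) powr (n - 3)) * \<bar>dq h u i (i - 1)\<bar>\<^sup>2)
         * node h v i)
     - (n - 2) / 24 * h * (\<Sum>i=1..Lh L h.
         (node h u (i + 1) powr (n - 3) + 2 * node h u i powr (n - 3)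
          + node h u (i - 1) powr (n - 3))
         * \<bar>dq h u (i + 1) (i - 1)\<bar>\<^sup>2 * node h v i)
     - (n - 2) / 24 * h * (\<Sum>i=1..Lh L h.
         (2 * node h u i powr (n - 3) - node h u (i + 1) powr (n - 3)
          - node h u (i - 1) powr (n - 3))
         * (\<bar>dq h u (i + 1) i\<bar>\<^sup>2 + \<bar>dq h u i (i - 1)\<bar>\<^sup>2) * node h v i)"

lemma Xh_ex1:
  assumes "0 < L" "0 < h" "L / h \<in> \<nat>" and per: "\<And>i. w (i + Lh L h) = w i"
  shows "\<exists>!v. v \<in> Xh L h \<and> (\<forall>i. node h v i = w i)"
proof -
  define v where "v x = w \<lfloor>x / h\<rfloor> + (x / h - of_int \<lfloor>x / h\<rfloor>) * (w (\<lfloor>x / h\<rfloor> + 1) - w \<lfloor>x / h\<rfloor>)"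
    for x
  have LN: "L / h = of_int (Lh L h)"
    using assms(3) unfolding Lh_def by (auto elim!: Nats_cases)
  have nodes: "node h v i = w i" for i
    using assms(2) by (simp add: node_def v_def)
  have aff: "v x = w (i - 1) + (x / h - of_int (i - 1)) * (w i - w (i - 1))"
    if "x \<in> {real_of_int (i - 1) * h..real_of_int i * h}" for x i
  proof (cases "x = real_of_int i * h")
    case True
    then show ?thesis using assms(2) by (simp add: v_def)
  next
    case False
    then have "real_of_int (i - 1) \<le> x / h" "x / h < real_of_int i"
      using that assms(2) by (simp_all add: field_simps)
    then have "\<lfloor>x / h\<rfloor> = i - 1" by (simp add: floor_eq_iff)
    then show ?thesis by (simp add: v_def)
  qed
  have cont1: "continuous_on {real_of_int (i - 1) * h..real_of_int i * h} v" for i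
  proof -
    have "continuous_on {real_of_int (i - 1) * h..real_of_int i * h}
        (\<lambda>x. w (i - 1) + (x / h - of_int (i - 1)) * (w i - w (i - 1)))"
      using assms(2) by (intro continuous_intros) auto
    then show ?thesis using aff continuous_on_cong by (metis (no_types, lifting))
  qed
  have "isCont v x" for x
  proof -
    define i where "i = \<lfloor>x / h\<rfloor>"
    have i: "of_int i \<le> x / h" "x / h < of_int i + 1"
      unfolding i_def by linarith+
    let ?A = "{real_of_int (i - 1) * h..real_of_int i * h}"
    let ?B = "{real_of_int ((i + 1) - 1) * h..real_of_int (i + 1) * h}"
    let ?O = "{real_of_int (i - 1) * h<..<real_of_int (i + 1) * h}"
    have "continuous_on (?A \<union> ?B) v"
      using cont1[of i] cont1[of "i + 1"] by (intro continuous_on_closed_Un) auto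
    moreover have "?O \<subseteq> ?A \<union> ?B" by auto
    ultimately have "continuous_on ?O v" by (rule continuous_on_subset)
    moreover have "x \<in> ?O" using i assms(2) by (simp add: field_simps)
    ultimately show ?thesis by (simp add: continuous_on_eq_continuous_at)
  qed
  then have cont: "continuous_on UNIV v" by (simp add: continuous_on_eq_continuous_at)
  have period: "v (x + L) = v x" for x
  proof -
    have q: "(x + L) / h = x / h + of_int (Lh L h)" by (simp add: add_divide_distrib LN)
    have p1: "w (Lh L h + i) = w i" "w (1 + (Lh L h + i)) = w (1 + i)" for i
      using per[of i] per[of "1 + i"] by (simp_all add: algebra_simps)
    show ?thesis unfolding v_def q by (simp add: p1 add.commute)
  qed
  have lin: "\<exists>a b. \<forall>x\<in>{real_of_int (i - 1) * h..real_of_int i * h}. v x = a * x + b" for i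
    using assms(2)
    by (intro exI[of _ "(w i - w (i - 1)) / h"]
        exI[of _ "w (i - 1) - of_int (i - 1) * (w i - w (i - 1))"])
      (auto simp: aff field_simps)
  have mem: "v \<in> Xh L h" unfolding Xh_def using period cont lin by blast
  have uniq: "f x = g x" if f: "f \<in> Xh L h" "\<And>i. node h f i = w i"
    and g: "g \<in> Xh L h" "\<And>i. node h g i = w i" for f g x
  proof -
    define i where "i = \<lfloor>x / h\<rfloor> + 1"
    let ?A = "{real_of_int (i - 1) * h..real_of_int i * h}"
    have i: "of_int (i - 1) \<le> x / h" "x / h < of_int i"
      unfolding i_def by (simp_all; linarith)+
    then have x: "x \<in> ?A" using assms(2) by (simp add: field_simps)
    obtain a b where ab: "\<forall>x\<in>?A. f x = a * x + b" using f(1) unfolding Xh_def by blast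
    obtain c d where cd: "\<forall>x\<in>?A. g x = c * x + d" using g(1) unfolding Xh_def by blast
    let ?l = "real_of_int (i - 1) * h" and ?r = "real_of_int i * h"
    have "?l < ?r" using assms(2) by simp
    have "f ?l = g ?l" "f ?r = g ?r"
      using f(2)[of "i - 1"] g(2)[of "i - 1"] f(2)[of i] g(2)[of i] by (simp_all add: node_def)
    then have e: "a * ?l + b = c * ?l + d" "a * ?r + b = c * ?r + d"
      using ab cd \<open>?l < ?r\<close> by auto
    then have "(a - c) * (?r - ?l) = 0"
      unfolding left_diff_distrib right_diff_distrib by linarith
    then have "a = c" using \<open>?l < ?r\<close> by (simp only: mult_eq_0_iff) auto
    then show ?thesis using e ab cd x by auto
  qed
  show ?thesis using mem nodes uniq by (intro ex1I[of _ v]) auto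
qed

lemma from_nodes:
  assumes "0 < L" "0 < h" "L / h \<in> \<nat>" "\<And>i. w (i + Lh L h) = w i"
  shows "from_nodes L h w \<in> Xh L h" "node h (from_nodes L h w) i = w i"
  using theI'[OF Xh_ex1[where w = w, OF assms(1-3), OF assms(4)]]
  unfolding from_nodes_def by auto

lemma node_periodic:
  assumes "0 < h" "L / h \<in> \<nat>" "\<And>x. f (x + L) = f x"
  shows "node h f (i + Lh L h) = node h f i"
proof -
  have "L / h = of_int (Lh L h)"
    using assms(2) unfolding Lh_def by (auto elim!: Nats_cases)
  then have "of_int (i + Lh L h) * h = of_int i * h + L"
    using assms(1) by (simp add: field_simps)
  then show ?thesis by (simp add: node_def assms(3))
qed

lemma node_Ih:
  assumes "0 < L" "0 < h" "L / h \<in> \<nat>" "\<And>x. f (x + L) = f x"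
  shows "Ih L h f \<in> Xh L h" "node h (Ih L h f) i = node h f i"
  unfolding Ih_def
  using from_nodes[where w = "node h f", OF assms(1-3)]
    node_periodic[where f = f, OF assms(2,3), OF assms(4)] by blast+

lemma node_Laph:
  assumes "0 < L" "0 < h" "L / h \<in> \<nat>" "u \<in> Xh L h"
  shows "Laph L h u \<in> Xh L h"
    and "node h (Laph L h u) i = (node h u (i + 1) - 2 * node h u i + node h u (i - 1)) / h\<^sup>2"
proof -
  let ?w = "\<lambda>i. (node h u (i + 1) - 2 * node h u i + node h u (i - 1)) / h\<^sup>2"
  have "\<And>x. u (x + L) = u x" using assms(4) unfolding Xh_def by blast
  then have p: "node h u (i + Lh L h) = node h u i" for i
    using assms(2,3) by (intro node_periodic) auto
  have "?w (i + Lh L h) = ?w i" for i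
    using p[of "i + 1"] p[of i] p[of "i - 1"] by (simp add: algebra_simps)
  from from_nodes[OF assms(1-3), of ?w, OF this]
  show "Laph L h u \<in> Xh L h" "node h (Laph L h u) i = ?w i"
    unfolding Laph_def by auto
qed

end

theory Submission
  imports Defs
begin

text \<open>
  Write \<open>d i = (u (i + 1) - u i) / h\<close> for the difference quotients of the nodal values \<open>u i\<close>, and
  \<open>\<phi> i = u i powr (n - 3)\<close>. In both forms, the factor in front of a nodal value \<open>v i\<close> of the test
  function is a quadratic polynomial in \<open>d (i - 1)\<close> and \<open>d i\<close> with weights \<open>\<phi> (i - 1)\<close>, \<open>\<phi> i\<close>,
  \<open>\<phi> (i + 1)\<close>. These polynomials are the same, so the forms agree for every test function
  (\<open>A_Delta_eq_A_nabla\<close>).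

  For the test function at hand, \<open>v i = - (d i - d (i - 1)) / h\<close>, and the summand is cubic. Up to a
  difference \<open>\<beta> (i + 1) - \<beta> i\<close>, whose sum over a period vanishes, it is a multiple of
  \<open>(\<phi> (i + 1) - \<phi> i) * d i * ((d (i - 1))\<^sup>2 + 2 * (d i)\<^sup>2 + (d (i + 1))\<^sup>2)\<close>: this is the
  summation by parts in \<open>A_Delta_summation_by_parts\<close>. The mean value theorem turns
  \<open>\<phi> (i + 1) - \<phi> i\<close> into \<open>(n - 3) * \<theta> i powr (n - 4) * h * d i\<close> with \<open>\<theta> i\<close> between \<open>u i\<close> and
  \<open>u (i + 1)\<close>, which yields the claimed formula. All terms in it are nonnegative because \<open>2 < n < 3\<close>.

  For the lower bound, the energy is rewritten as
  \<open>h * (\<Sum>i. 1/2 * (d i)\<^sup>2 + F (u i))\<close> (\<open>Eh_nodal\<close>). The energy bound applied to a single potential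
  term gives \<open>u i \<ge> h powr (2 / (p + 2))\<close>; applied to a single gradient term, it gives
  \<open>\<bar>u (i + 1) - u i\<bar> \<le> sqrt (2 * cF) * h powr (2 / (p + 2))\<close>. The exponent in the hypothesis is the
  one for which these two powers of \<open>h\<close> coincide, so neighbouring nodal values differ at most by
  the factor \<open>Cosc cF\<close> (\<open>node_ratio_le_Cosc\<close>). Hence \<open>\<theta> i\<close> and \<open>\<theta> (i - 1)\<close> are both bounded by a
  multiple of \<open>u i\<close>. It remains to shift the index in the terms with \<open>d (i + 1)\<close>, so that they become
  a second copy of the terms with \<open>d (i - 1)\<close>.
\<close>

section \<open>Sums over one period\<close>

lemma sum_shift_periodic:
  fixes g :: "int \<Rightarrow> real"
  assumes "0 \<le> M" "\<And>i. g (i + M) = g i"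
  shows "(\<Sum>i=1..M. g (i + 1)) = (\<Sum>i=1..M. g i)"
proof -
  have tele: "(\<Sum>i=1..int N. g (i + 1) - g i) = g (int N + 1) - g 1" for N
  proof (induction N)
    case (Suc N)
    have "{1..int (Suc N)} = insert (int N + 1) {1..int N}" by auto
    then show ?case using Suc by (simp add: algebra_simps)
  qed simp
  show ?thesis
    using tele[of "nat M"] assms(1) assms(2)[of 1] by (simp add: sum_subtractf algebra_simps)
qed

text \<open>
  This localizes a bound on a sum over a period at an arbitrary index. Working with all integer
  indices makes the neighbours of the first and the last node unexceptional.
\<close>

lemma periodic_le_sum_period:
  fixes g :: "int \<Rightarrow> real"
  assumes "0 < M" and per: "\<And>i. g (i + M) = g i" and "\<And>i. 0 \<le> g i"
  shows "g j \<le> (\<Sum>i=1..M. g i)"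
proof -
  have mult: "g (i + k * M) = g i" for i k
  proof (induction k rule: int_induct[where k = 0])
    case (step1 k)
    then show ?case using per[of "i + k * M"] by (simp add: algebra_simps)
  next
    case (step2 k)
    then show ?case using per[of "i + (k - 1) * M"] by (simp add: algebra_simps)
  qed simp
  \<comment> \<open>the representative of \<open>j\<close> in \<open>{1..M}\<close>, rather than in \<open>{0..M - 1}\<close>\<close>
  define r where "r = (j - 1) mod M + 1"
  have "r + ((j - 1) div M) * M = j"
    unfolding r_def using mod_div_mult_eq[of "j - 1" M] by linarith
  then have "g j = g r" using mult[of r "(j - 1) div M"] by simp
  moreover have "r \<in> {1..M}"
    unfolding r_def using assms(1) pos_mod_bound[of M "j - 1"] pos_mod_sign[of M "j - 1"]
    by (simp; linarith)
  ultimately show ?thesis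
    using member_le_sum[of r "{1..M}" g] assms(3) by simp
qed

section \<open>The energy in nodal values\<close>

text \<open>
  On one cell the integrand is affine except at the two end points, where \<open>deriv u\<close> is unspecified;
  two points do not change the integral, and an affine function integrates by the trapezoidal rule.
\<close>

lemma has_integral_cell:
  assumes "0 < h" and u: "u \<in> Xh L h" and w: "w \<in> Xh L h"
  shows "((\<lambda>x. 1/2 * \<bar>deriv u x\<bar>\<^sup>2 + w x) has_integral
      h * (1/2 * \<bar>dq h u i (i - 1)\<bar>\<^sup>2 + (node h w (i - 1) + node h w i) / 2))
    {real_of_int (i - 1) * h..real_of_int i * h}"
proof -
  let ?l = "real_of_int (i - 1) * h" and ?r = "real_of_int i * h"
  obtain a b where ab: "\<And>x. x \<in> {?l..?r} \<Longrightarrow> u x = a * x + b"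
    using u unfolding Xh_def by blast
  obtain c e where ce: "\<And>x. x \<in> {?l..?r} \<Longrightarrow> w x = c * x + e"
    using w unfolding Xh_def by blast
  have lr: "?r = ?l + h" by (simp add: algebra_simps)
  have slope: "dq h u i (i - 1) = a"
    using ab[of ?l] ab[of ?r] assms(1) lr by (simp add: dq_def node_def field_simps)
  have deriv: "deriv u x = a" if "x \<in> {?l<..<?r}" for x
  proof -
    have "((\<lambda>x. a * x + b) has_field_derivative a) (at x)"
      by (auto intro!: derivative_eq_intros)
    then have "(u has_field_derivative a) (at x)"
      by (rule has_field_derivative_transform_within_open[of _ _ _ "{?l<..<?r}"])
        (use that in \<open>auto simp: ab\<close>)
    then show ?thesis by (rule DERIV_imp_deriv)
  qed
  let ?P = "\<lambda>x. 1/2 * a\<^sup>2 * x + c * x\<^sup>2 / 2 + e * x"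
  have "((\<lambda>x. 1/2 * a\<^sup>2 + (c * x + e)) has_integral (?P ?r - ?P ?l)) {?l..?r}"
    using assms(1)
    by (intro fundamental_theorem_of_calculus)
      (auto intro!: derivative_eq_intros simp flip: has_real_derivative_iff_has_vector_derivative)
  moreover have "?P ?r - ?P ?l =
      h * (1/2 * \<bar>dq h u i (i - 1)\<bar>\<^sup>2 + (node h w (i - 1) + node h w i) / 2)"
  proof -
    have nodes: "node h w (i - 1) = c * ?l + e" "node h w i = c * ?r + e"
      using ce[of ?l] ce[of ?r] assms(1) lr by (simp_all add: node_def)
    show ?thesis unfolding slope nodes lr by (simp add: field_simps power2_eq_square)
  qed
  ultimately have "((\<lambda>x. 1/2 * a\<^sup>2 + (c * x + e)) has_integral
      h * (1/2 * \<bar>dq h u i (i - 1)\<bar>\<^sup>2 + (node h w (i - 1) + node h w i) / 2)) {?l..?r}" by simp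
  then show ?thesis
    by (rule has_integral_spike_finite[of "{?l, ?r}", rotated 2])
      (auto simp: deriv ce less_le)
qed

lemma Lh_props:
  assumes "0 < L" "0 < h" "L / h \<in> \<nat>"
  shows "0 < Lh L h" "real_of_int (Lh L h) * h = L"
proof -
  have "L / h = of_int (Lh L h)"
    using assms(3) unfolding Lh_def by (auto elim!: Nats_cases)
  then show eq: "real_of_int (Lh L h) * h = L" using assms(2) by (simp add: field_simps)
  show "0 < Lh L h"
    using assms(1,2) eq by (metis of_int_0_less_iff zero_less_mult_pos2)
qed

lemma node_Xh_periodic:
  assumes "0 < h" "L / h \<in> \<nat>" "u \<in> Xh L h"
  shows "node h u (i + Lh L h) = node h u i"
  using assms by (intro node_periodic) (auto simp: Xh_def)

text \<open>
  Summing the cells, each nodal value of the interpolated potential receives half its weight from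
  the cell on either side. Cell \<open>i\<close> carries the slope \<open>dq h u i (i - 1)\<close>, so both the slopes and the
  left halves are brought to index \<open>i\<close> by a shift over the period.
\<close>

lemma Eh_nodal:
  assumes "0 < L" "0 < h" "L / h \<in> \<nat>" and u: "u \<in> Xh L h"
  shows "Eh L h cF p u =
    h * (\<Sum>i=1..Lh L h. 1/2 * \<bar>dq h u (i + 1) i\<bar>\<^sup>2 + F cF p (node h u i))"
proof -
  let ?f = "\<lambda>y. F cF p (u y)" and ?M = "Lh L h"
  let ?w = "Ih L h ?f"
  have "\<And>x. ?f (x + L) = ?f x" using u by (simp add: Xh_def)
  note I = node_Ih[where f = ?f, OF assms(1-3) this]
  have w: "?w \<in> Xh L h" and wn: "\<And>i. node h ?w i = F cF p (node h u i)"
    using I by (auto simp: node_def)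
  define s where
    "s i = h * (1/2 * \<bar>dq h u i (i - 1)\<bar>\<^sup>2 + (node h ?w (i - 1) + node h ?w i) / 2)" for i
  have cells: "((\<lambda>x. 1/2 * \<bar>deriv u x\<bar>\<^sup>2 + ?w x) has_integral (\<Sum>i=1..int N. s i))
      {0..real_of_int (int N) * h}" for N
  proof (induction N)
    case (Suc N)
    have "{1..int (Suc N)} = insert (int N + 1) {1..int N}" by auto
    then have sum: "(\<Sum>i=1..int (Suc N). s i) = (\<Sum>i=1..int N. s i) + s (int (Suc N))"
      by (simp add: add.commute)
    have ends: "0 \<le> real_of_int (int N) * h"
      "real_of_int (int N) * h \<le> real_of_int (int (Suc N)) * h"
      using assms(2) by simp_all
    have "((\<lambda>x. 1/2 * \<bar>deriv u x\<bar>\<^sup>2 + ?w x) has_integral s (int (Suc N)))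
        {real_of_int (int N) * h..real_of_int (int (Suc N)) * h}"
      using has_integral_cell[OF assms(2) u w, of "int (Suc N)"] unfolding s_def by simp
    from has_integral_combine[OF ends Suc this] show ?case unfolding sum .
  qed (simp add: has_integral_refl)
  have "((\<lambda>x. 1/2 * \<bar>deriv u x\<bar>\<^sup>2 + ?w x) has_integral (\<Sum>i=1..?M. s i)) {0..L}"
    using cells[of "nat ?M"] Lh_props[OF assms(1-3)] by simp
  then have "Eh L h cF p u = (\<Sum>i=1..?M. s i)"
    unfolding Eh_def by (rule integral_unique)
  also have "\<dots> = (\<Sum>i=1..?M. h * (1/2 * \<bar>dq h u (i + 1) i\<bar>\<^sup>2 + F cF p (node h u i)))"
  proof -
    \<comment> \<open>the part of the cell integrals that has to be moved by one index\<close>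
    define e where "e i = 1/2 * \<bar>dq h u (i + 1) i\<bar>\<^sup>2 + F cF p (node h u i) / 2" for i
    have "e (i + ?M) = e i" for i
      using node_Xh_periodic[OF assms(2,3) u, of i] node_Xh_periodic[OF assms(2,3) u, of "i + 1"]
      by (simp add: e_def dq_def algebra_simps)
    from this[of "i - 1" for i] have per: "e (i + ?M - 1) = e (i - 1)" for i
      by (simp add: algebra_simps)
    have "(\<Sum>i=1..?M. s i) = (\<Sum>i=1..?M. h * e (i - 1)) + (\<Sum>i=1..?M. h * (F cF p (node h u i) / 2))"
      unfolding sum.distrib[symmetric] s_def e_def wn
      by (intro sum.cong) (auto simp: field_simps)
    also have "(\<Sum>i=1..?M. h * e (i - 1)) = (\<Sum>i=1..?M. h * e i)"
      using sum_shift_periodic[of ?M "\<lambda>i. h * e (i - 1)"] per Lh_props(1)[OF assms(1-3)] by simp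
    also have "\<dots> + (\<Sum>i=1..?M. h * (F cF p (node h u i) / 2)) =
        (\<Sum>i=1..?M. h * (1/2 * \<bar>dq h u (i + 1) i\<bar>\<^sup>2 + F cF p (node h u i)))"
      unfolding sum.distrib[symmetric] e_def by (intro sum.cong) (auto simp: field_simps)
    finally show ?thesis .
  qed
  finally show ?thesis by (simp only: sum_distrib_left)
qed

section \<open>The oscillation of low-energy functions\<close>

text \<open>
  Both terms of the energy are nonnegative, so each single one is bounded by the total. With
  \<open>q = 2 / (p + 2)\<close>, the potential term prevents the nodal values from falling below \<open>h powr q\<close>, and the
  gradient term prevents neighbours from differing by more than \<open>sqrt (2 * cF) * h powr q\<close>.
\<close>

lemma node_ratio_le_Cosc:
  assumes "0 < L" "0 < h" "L / h \<in> \<nat>" "0 < p" "0 < cF"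
    and u: "u \<in> Xh L h" and pos: "\<And>x. 0 < u x"
    and E: "Eh L h cF p u \<le> cF * h powr (- ((p - 2) / (p + 2)))"
    and "j = i + 1 \<or> j = i - 1"
  shows "node h u j \<le> Cosc cF * node h u i"
proof -
  define q where "q = 2 / (p + 2)"
  let ?g = "\<lambda>i. 1/2 * \<bar>dq h u (i + 1) i\<bar>\<^sup>2 + F cF p (node h u i)"
  have npos: "0 < node h u k" for k using pos by (simp add: node_def)
  have F0: "0 \<le> F cF p x" for x using assms(5) by (simp add: F_def)
  have per: "?g (k + Lh L h) = ?g k" for k
    using node_Xh_periodic[OF assms(2,3) u, of k] node_Xh_periodic[OF assms(2,3) u, of "k + 1"]
    by (simp add: dq_def algebra_simps)
  have bound: "h * ?g k \<le> cF * h powr (- ((p - 2) / (p + 2)))" for k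
  proof -
    have "0 \<le> ?g i" for i using F0 by simp
    from periodic_le_sum_period[of "Lh L h" ?g, OF Lh_props(1)[OF assms(1-3)] per this]
    have "h * ?g k \<le> Eh L h cF p u"
      unfolding Eh_nodal[OF assms(1-3) u] using assms(2) by (intro mult_left_mono) auto
    then show ?thesis using E by (rule order_trans)
  qed
  have exps: "- ((p - 2) / (p + 2)) - 1 = - p * q" "1 - (p - 2) / (p + 2) = 2 * q"
    using assms(4) by (simp_all add: q_def field_simps)
  have lower: "h powr q \<le> node h u k" for k
  proof -
    have "h * (cF * node h u k powr (- p)) \<le> h * ?g k"
      using assms(2) by (intro mult_left_mono) (auto simp: F_def)
    also note bound[of k]
    finally have "node h u k powr (- p) \<le> h powr (- ((p - 2) / (p + 2))) / h"
      using assms(2,5) by (simp add: pos_le_divide_eq mult.commute mult.left_commute)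
    also have "\<dots> = h powr (- ((p - 2) / (p + 2)) - 1)"
      using assms(2) by (simp add: powr_diff)
    also have "\<dots> = h powr (- p * q)" by (simp only: exps(1))
    also have "\<dots> = (h powr q) powr (- p)" by (simp add: powr_powr mult.commute)
    finally have "\<not> (h powr q) powr (- p) < node h u k powr (- p)" by simp
    then show ?thesis
      using powr_less_mono2_neg[of "- p" "node h u k" "h powr q"] npos[of k] assms(4)
      by linarith
  qed
  have diff: "\<bar>node h u (k + 1) - node h u k\<bar> \<le> sqrt (2 * cF) * h powr q" for k
  proof -
    have "h * (1/2 * \<bar>dq h u (k + 1) k\<bar>\<^sup>2) \<le> h * ?g k"
      using assms(2) F0 by (intro mult_left_mono) auto
    also note bound[of k]
    finally have *: "h * (1/2 * \<bar>dq h u (k + 1) k\<bar>\<^sup>2) \<le> cF * h powr (- ((p - 2) / (p + 2)))" .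
    have "\<bar>node h u (k + 1) - node h u k\<bar>\<^sup>2 = 2 * h * (h * (1/2 * \<bar>dq h u (k + 1) k\<bar>\<^sup>2))"
      using assms(2) by (simp add: dq_def power2_eq_square)
    also have "\<dots> \<le> 2 * h * (cF * h powr (- ((p - 2) / (p + 2))))"
      using * assms(2) by (intro mult_left_mono) auto
    also have "\<dots> = 2 * cF * h powr (1 - (p - 2) / (p + 2))"
      using assms(2) by (simp add: powr_diff powr_minus divide_inverse)
    also have "\<dots> = (sqrt (2 * cF) * h powr q)\<^sup>2"
    proof -
      have "(h powr q)\<^sup>2 = h powr (2 * q)"
        unfolding power2_eq_square powr_add[symmetric] by simp
      then show ?thesis
        unfolding exps(2) power_mult_distrib using assms(5) by simp
    qed
    finally show ?thesis by (rule power2_le_imp_le) (use assms(5) in simp)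
  qed
  have "\<bar>node h u j - node h u i\<bar> \<le> sqrt (2 * cF) * h powr q"
    using assms(9)
  proof
    assume "j = i - 1"
    then have "i = j + 1" by simp
    then show ?thesis using diff[of j] abs_minus_commute[of "node h u j" "node h u i"] by metis
  next
    assume "j = i + 1"
    then show ?thesis using diff[of i] by blast
  qed
  also have "\<dots> \<le> sqrt (2 * cF) * node h u i"
    using lower[of i] assms(5) by (intro mult_left_mono) auto
  finally show ?thesis unfolding Cosc_def by (simp add: algebra_simps)
qed

section \<open>The equality of the two forms\<close>

text \<open>
  Here \<open>x\<close>, \<open>y\<close> stand for the backward and forward difference quotients, \<open>s\<close>, \<open>q\<close>, \<open>p\<close> for the weights
  at the nodes \<open>i - 1\<close>, \<open>i\<close>, \<open>i + 1\<close>, and \<open>v\<close> for the value of the test function. On both sides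
  \<open>- (c * h * v) / 12\<close> is multiplied by
  \<open>p * y * (x + y) + s * x * (x + y) + q * (2 * (x\<^sup>2 + y\<^sup>2) + (x + y)\<^sup>2)\<close>.
\<close>

lemma A_summand_identity:
  fixes c h v x y p q s :: real
  shows "- (c / 6) * h * (q * (x\<^sup>2 + y\<^sup>2) * v)
      - c / 6 * h * (((q + p) * y + (s + q) * x) * ((y + x) / 2) * v)
    = - (c / 12) * h * (((q + p) * y\<^sup>2 + (q + s) * x\<^sup>2) * v)
      - c / 24 * h * ((p + 2 * q + s) * (y + x)\<^sup>2 * v)
      - c / 24 * h * ((2 * q - p - s) * (y\<^sup>2 + x\<^sup>2) * v)"
  by (simp add: algebra_simps power2_eq_square add_divide_distrib diff_divide_distrib)

lemma A_Delta_eq_A_nabla: "A_Delta n L h u v = A_nabla n L h u v"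
proof -
  have split: "dq h u (i + 1) (i - 1) = dq h u (i + 1) i + dq h u i (i - 1)"
    "(node h u (i + 1) - node h u (i - 1)) / (2 * h) = (dq h u (i + 1) i + dq h u i (i - 1)) / 2"
    for i by (simp_all add: dq_def diff_divide_distrib)
  show ?thesis
    unfolding A_Delta_def A_nabla_def split power2_abs
      sum_distrib_left sum_negf[symmetric] sum_subtractf[symmetric]
    by (intro sum.cong refl) (rule A_summand_identity)
qed

section \<open>Summation by parts\<close>

lemma node_minus_Laph:
  assumes "0 < L" "0 < h" "L / h \<in> \<nat>" "u \<in> Xh L h"
  shows "node h (\<lambda>x. - Laph L h u x) i = (- 1 / h) * (dq h u (i + 1) i - dq h u i (i - 1))"
proof -
  have eq: "node h (\<lambda>x. - Laph L h u x) i = - node h (Laph L h u) i" by (simp add: node_def)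
  show ?thesis
    unfolding eq node_Laph(2)[OF assms] using assms(2)
    by (simp add: dq_def field_simps power2_eq_square)
qed

text \<open>
  The notation is that of \<open>A_summand_identity\<close>, with \<open>z\<close> for the difference quotient
  following \<open>y\<close>. The summand is split into its terms with a factor \<open>y\<close> outside the squares minus those with such a factor \<open>x\<close>. Read
  at index \<open>i + 1\<close>, the latter have outer factor \<open>y\<close> as well; they form the first two products inside
  the bracket on the right. Replacing the \<open>x\<close>-terms by these shifted ones leaves, up to its
  sign, the last product, which contains the weights only through \<open>p - q\<close>.
\<close>

lemma parts_summand_identity:
  fixes c x y z p q s :: real
  shows "c / 6 * (q * (x\<^sup>2 + y\<^sup>2) * (y - x))
      + c / 6 * (((q + p) * y + (s + q) * x) * ((y + x) / 2) * (y - x))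
    = c / 12 * (p * (3 * y ^ 3 + y * z\<^sup>2) - q * y * (z\<^sup>2 - y\<^sup>2)
      - (q * (3 * x ^ 3 + x * y\<^sup>2) - s * x * (y\<^sup>2 - x\<^sup>2))
      - (p - q) * y * (x\<^sup>2 + 2 * y\<^sup>2 + z\<^sup>2))"
  by (simp add: algebra_simps power2_eq_square power3_eq_cube
      add_divide_distrib diff_divide_distrib)

lemma A_Delta_summation_by_parts:
  assumes "0 < L" "0 < h" "L / h \<in> \<nat>" and u: "u \<in> Xh L h"
  shows "A_Delta n L h u (\<lambda>x. - Laph L h u x) =
    - ((n - 2) / 12) * (\<Sum>i=1..Lh L h.
        (node h u (i + 1) powr (n - 3) - node h u i powr (n - 3)) * dq h u (i + 1) i
        * (\<bar>dq h u i (i - 1)\<bar>\<^sup>2 + 2 * \<bar>dq h u (i + 1) i\<bar>\<^sup>2 + \<bar>dq h u (i + 2) (i + 1)\<bar>\<^sup>2))"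
proof -
  let ?M = "Lh L h"
  define \<phi> where "\<phi> i = node h u i powr (n - 3)" for i
  define d where "d i = dq h u (i + 1) i" for i
  \<comment> \<open>the terms with outer factor \<open>d (i - 1)\<close>, which the summation by parts moves to the next index\<close>
  define \<beta> where "\<beta> i = \<phi> i * (3 * d (i - 1) ^ 3 + d (i - 1) * (d i)\<^sup>2)
      - \<phi> (i - 1) * d (i - 1) * ((d i)\<^sup>2 - (d (i - 1))\<^sup>2)" for i
  define t where "t i = (\<phi> (i + 1) - \<phi> i) * d i * ((d (i - 1))\<^sup>2 + 2 * (d i)\<^sup>2 + (d (i + 1))\<^sup>2)" for i
  note per = node_Xh_periodic[OF assms(2,3) u]
  have \<phi>per: "\<phi> (i + ?M) = \<phi> i" for i using per by (simp add: \<phi>_def)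
  have dper: "d (i + ?M) = d i" for i
    using per[of i] per[of "i + 1"] by (simp add: d_def dq_def algebra_simps)
  have "\<beta> (i + ?M) = \<beta> i" for i
    using \<phi>per[of i] \<phi>per[of "i - 1"] dper[of i] dper[of "i - 1"]
    by (simp add: \<beta>_def algebra_simps)
  then have shift: "(\<Sum>i=1..?M. \<beta> (i + 1)) = (\<Sum>i=1..?M. \<beta> i)"
    using sum_shift_periodic[of ?M \<beta>] Lh_props(1)[OF assms(1-3)] by simp
  have dq: "dq h u (i + 1) i = d i" "dq h u i (i - 1) = d (i - 1)"
    "dq h u (i + 2) (i + 1) = d (i + 1)"
    "(node h u (i + 1) - node h u (i - 1)) / (2 * h) = (d i + d (i - 1)) / 2" for i
    by (simp_all add: d_def dq_def diff_divide_distrib algebra_simps)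
  have \<phi>: "node h u i powr (n - 3) = \<phi> i" for i by (simp add: \<phi>_def)
  have "A_Delta n L h u (\<lambda>x. - Laph L h u x) =
      (n - 2) / 12 * (\<Sum>i=1..?M. \<beta> (i + 1) - \<beta> i - t i)"
    unfolding A_Delta_def node_minus_Laph[OF assms(1-3) u] dq \<phi> power2_abs
      sum_distrib_left sum_negf[symmetric] sum_subtractf[symmetric]
  proof (intro sum.cong refl)
    fix i
    have cancel: "- k * h * (a * (- 1 / h * z)) - k * h * (b * (- 1 / h * z)) =
        k * (a * z) + k * (b * z)" for a b k z
      using assms(2) by simp
    have "- ((n - 2) / 6) * h * (\<phi> i * ((d (i - 1))\<^sup>2 + (d i)\<^sup>2) * (- 1 / h * (d i - d (i - 1))))
      - (n - 2) / 6 * h * (((\<phi> i + \<phi> (i + 1)) * d i + (\<phi> (i - 1) + \<phi> i) * d (i - 1))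
        * ((d i + d (i - 1)) / 2) * (- 1 / h * (d i - d (i - 1))))
      = (n - 2) / 6 * (\<phi> i * ((d (i - 1))\<^sup>2 + (d i)\<^sup>2) * (d i - d (i - 1)))
      + (n - 2) / 6 * (((\<phi> i + \<phi> (i + 1)) * d i + (\<phi> (i - 1) + \<phi> i) * d (i - 1))
        * ((d i + d (i - 1)) / 2) * (d i - d (i - 1)))"
      by (rule cancel)
    also have "\<dots> = (n - 2) / 12 * (\<beta> (i + 1) - \<beta> i - t i)"
      unfolding \<beta>_def t_def add_diff_cancel_right' by (rule parts_summand_identity)
    finally show "- ((n - 2) / 6) * h * (\<phi> i * ((d (i - 1))\<^sup>2 + (d i)\<^sup>2) * (- 1 / h * (d i - d (i - 1))))
      - (n - 2) / 6 * h * (((\<phi> i + \<phi> (i + 1)) * d i + (\<phi> (i - 1) + \<phi> i) * d (i - 1))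
        * ((d i + d (i - 1)) / 2) * (- 1 / h * (d i - d (i - 1))))
      = (n - 2) / 12 * (\<beta> (i + 1) - \<beta> i - t i)" .
  qed
  also have "\<dots> = - ((n - 2) / 12) * (\<Sum>i=1..?M. t i)"
    by (simp add: sum_subtractf shift)
  finally show ?thesis
    unfolding t_def d_def \<phi>_def by (simp add: add.commute add.left_commute)
qed

section \<open>The mean value weights and the main estimate\<close>

text \<open>
  Consecutive nodal values may come in either order or coincide. Writing the intermediate point as a
  convex combination, with a weight that may be an end point of the unit interval, covers all cases.
\<close>

lemma powr_mean_value:
  fixes a b r :: real
  assumes "0 < a" "0 < b"
  shows "\<exists>s. 0 \<le> s \<and> s \<le> 1 \<and>
    b powr r - a powr r = r * (s * a + (1 - s) * b) powr (r - 1) * (b - a)"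
proof -
  have mvt: "\<exists>z. x < z \<and> z < y \<and> y powr r - x powr r = (y - x) * (r * z powr (r - 1))"
    if "0 < x" "x < y" for x y :: real
    using that by (intro MVT2) (auto intro!: derivative_eq_intros)
  have between: "\<exists>s. 0 \<le> s \<and> s \<le> 1 \<and> z = s * x + (1 - s) * y"
    if "x \<le> z" "z \<le> y" "x < y" for x y z :: real
  proof -
    have "z = y - (y - z) / (y - x) * (y - x)" using that by simp
    also have "\<dots> = (y - z) / (y - x) * x + (1 - (y - z) / (y - x)) * y"
      by (simp only: algebra_simps)
    finally show ?thesis using that by (intro exI[of _ "(y - z) / (y - x)"]) auto
  qed
  consider "a = b" | "a < b" | "b < a" by linarith
  then show ?thesis
  proof cases
    case 2
    then obtain z where z: "a < z" "z < b" "b powr r - a powr r = (b - a) * (r * z powr (r - 1))"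
      using mvt assms by blast
    with between[of a z b] obtain s where "0 \<le> s" "s \<le> 1" "z = s * a + (1 - s) * b" by auto
    moreover have "b powr r - a powr r = r * z powr (r - 1) * (b - a)"
      using z(3) by (simp only: ac_simps)
    ultimately show ?thesis by blast
  next
    case 3
    then obtain z where z: "b < z" "z < a" "a powr r - b powr r = (a - b) * (r * z powr (r - 1))"
      using mvt assms by blast
    with between[of b z a] obtain s where "0 \<le> s" "s \<le> 1" "z = s * b + (1 - s) * a" by auto
    moreover have "b powr r - a powr r = r * z powr (r - 1) * (b - a)"
      using z(3) by (simp add: algebra_simps)
    ultimately show ?thesis by (intro exI[of _ "1 - s"]) (simp add: add.commute)
  qed auto
qed

theorem lemma6p2:
  fixes L h n p cF :: real and u :: "real \<Rightarrow> real"
  assumes "0 < L" and "0 < h" and "L / h \<in> \<nat>"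
    and "2 < n" and "n < 3" and "n < p" and "0 < cF"
    and "u \<in> Xh L h" and "\<forall>x. 0 < u x"
    and "Eh L h cF p u \<le> cF * h powr (- ((p - 2) / (p + 2)))"
  shows "A_Delta n L h u (\<lambda>x. - Laph L h u x) = A_nabla n L h u (\<lambda>x. - Laph L h u x) \<and>
    (\<exists>\<sigma> :: int \<Rightarrow> real. (\<forall>i\<in>{1..Lh L h}. 0 \<le> \<sigma> i \<and> \<sigma> i \<le> 1) \<and>
      (let \<theta> = (\<lambda>i. \<sigma> i * node h u i + (1 - \<sigma> i) * node h u (i + 1));
           S = 1/4 * (\<bar>(n - 2) * (n - 3)\<bar> / 3) * h * (\<Sum>i=1..Lh L h.
                 \<theta> i powr (n - 4) * \<bar>dq h u (i + 1) i\<bar>\<^sup>2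
                 * (\<bar>dq h u i (i - 1)\<bar>\<^sup>2 + 2 * \<bar>dq h u (i + 1) i\<bar>\<^sup>2 + \<bar>dq h u (i + 2) (i + 1)\<bar>\<^sup>2))
       in A_Delta n L h u (\<lambda>x. - Laph L h u x) = S \<and>
          S \<ge> \<bar>(n - 2) * (n - 3)\<bar> / 3 * ((1 + Cosc cF) powr (n - 4) / 2) * h * (\<Sum>i=1..Lh L h.
                 node h u i powr (n - 4)
                 * (\<bar>dq h u (i + 1) i\<bar>\<^sup>2 * \<bar>dq h u i (i - 1)\<bar>\<^sup>2 + \<bar>dq h u (i + 1) i\<bar> ^ 4))))"
proof -
  let ?M = "Lh L h" and ?U = "node h u"
  have pos: "0 < ?U i" for i using assms(9) by (simp add: node_def)
  have per: "?U (i + ?M) = ?U i" for i using node_Xh_periodic[OF assms(2,3,8)] .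
  have C1: "1 \<le> Cosc cF" using assms(7) by (simp add: Cosc_def)
  have osc: "?U (i + 1) \<le> Cosc cF * ?U i" "?U i \<le> Cosc cF * ?U (i + 1)" for i
    using node_ratio_le_Cosc[OF assms(1-3) _ assms(7,8) _ assms(10)] assms(4,6,9) by auto
  \<comment> \<open>The weight is chosen as a function of the two nodal values instead of the index, which makes
    \<open>\<sigma>\<close> and \<open>\<theta>\<close> periodic.\<close>
  have "\<forall>a b. \<exists>s. 0 < a \<longrightarrow> 0 < b \<longrightarrow> 0 \<le> s \<and> s \<le> 1 \<and>
      b powr (n - 3) - a powr (n - 3) = (n - 3) * (s * a + (1 - s) * b) powr (n - 4) * (b - a)"
    using powr_mean_value[of _ _ "n - 3"] by simp
  then obtain s where s: "0 \<le> s a b" "s a b \<le> 1" "b powr (n - 3) - a powr (n - 3) =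
      (n - 3) * (s a b * a + (1 - s a b) * b) powr (n - 4) * (b - a)"
    if "0 < a" "0 < b" for a b :: real
    by metis
  define \<sigma> where "\<sigma> i = s (?U i) (?U (i + 1))" for i
  define \<theta> where "\<theta> i = \<sigma> i * ?U i + (1 - \<sigma> i) * ?U (i + 1)" for i
  define d where "d i = dq h u (i + 1) i" for i
  have \<sigma>: "0 \<le> \<sigma> i" "\<sigma> i \<le> 1" for i using s pos by (simp_all add: \<sigma>_def)
  have \<theta>MVT: "?U (i + 1) powr (n - 3) - ?U i powr (n - 3) =
      (n - 3) * \<theta> i powr (n - 4) * h * d i" for i
    using s(3)[OF pos[of i] pos[of "i + 1"]] assms(2)
    by (simp add: \<theta>_def \<sigma>_def d_def dq_def)
  have \<theta>pos: "0 < \<theta> i" for i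
    unfolding \<theta>_def using \<sigma>[of i] pos[of i] pos[of "i + 1"]
    by (cases "\<sigma> i = 0") (auto intro!: add_pos_nonneg)
  have \<theta>le: "\<theta> i \<le> (1 + Cosc cF) * ?U i" "\<theta> i \<le> (1 + Cosc cF) * ?U (i + 1)" for i
  proof -
    have *: "x \<le> (1 + Cosc cF) * x" "y \<le> Cosc cF * x \<Longrightarrow> y \<le> (1 + Cosc cF) * x"
      if "0 < x" for x y using that C1 by (auto simp: algebra_simps)
    show "\<theta> i \<le> (1 + Cosc cF) * ?U i" "\<theta> i \<le> (1 + Cosc cF) * ?U (i + 1)"
      unfolding \<theta>_def using \<sigma> pos osc * C1 order_trans[OF zero_le_one C1]
      by (auto intro!: convex_bound_le)
  qed
  \<comment> \<open>the exponent \<open>n - 4\<close> is negative, so that upper bounds on \<open>\<theta>\<close> become lower bounds\<close>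
  have weight: "(1 + Cosc cF) powr (n - 4) * x powr (n - 4) \<le> \<theta> i powr (n - 4)"
    if "\<theta> i \<le> (1 + Cosc cF) * x" "0 < x" for i x
    using powr_mono2'[of "n - 4" "\<theta> i" "(1 + Cosc cF) * x"] that \<theta>pos[of i] assms(5) C1
    by (simp add: powr_mult)
  have per\<theta>: "\<theta> (i + ?M) = \<theta> i" and perd: "d (i + ?M) = d i" for i
    using per[of i] per[of "i + 1"] by (simp_all add: \<theta>_def \<sigma>_def d_def dq_def algebra_simps)
  have dq: "dq h u (i + 1) i = d i" "dq h u i (i - 1) = d (i - 1)"
    "dq h u (i + 2) (i + 1) = d (i + 1)" for i
    by (simp_all add: d_def dq_def algebra_simps)
  define K where "K = \<bar>(n - 2) * (n - 3)\<bar> / 3"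
  have K: "K = (n - 2) * (3 - n) / 3" "0 \<le> K"
    using assms(4,5) by (simp_all add: K_def abs_mult)
  define S where "S = 1/4 * K * h * (\<Sum>i=1..?M.
      \<theta> i powr (n - 4) * \<bar>d i\<bar>\<^sup>2 * (\<bar>d (i - 1)\<bar>\<^sup>2 + 2 * \<bar>d i\<bar>\<^sup>2 + \<bar>d (i + 1)\<bar>\<^sup>2))"
  have rearrange: "- ((n - 2) / 12) * ((n - 3) * a * h * b * b * w) =
      1/4 * ((n - 2) * (3 - n) / 3) * h * (a * \<bar>b\<bar>\<^sup>2 * w)" for a b w
    by (simp add: field_simps power2_eq_square)
  have eq: "A_Delta n L h u (\<lambda>x. - Laph L h u x) = S"
    unfolding A_Delta_summation_by_parts[OF assms(1-3,8)] S_def K(1) \<theta>MVT dq sum_distrib_left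
    by (simp only: rearrange)
  have "K * ((1 + Cosc cF) powr (n - 4) / 2) * h * (\<Sum>i=1..?M.
      ?U i powr (n - 4) * (\<bar>d i\<bar>\<^sup>2 * \<bar>d (i - 1)\<bar>\<^sup>2 + \<bar>d i\<bar> ^ 4)) =
    1/4 * K * h * (\<Sum>i=1..?M. (1 + Cosc cF) powr (n - 4) * ?U i powr (n - 4) *
      (2 * (d i)\<^sup>2 * (d (i - 1))\<^sup>2 + 2 * (d i) ^ 4))"
    unfolding sum_distrib_left by (intro sum.cong refl) (simp add: field_simps)
  \<comment> \<open>One of the two products \<open>(d i)\<^sup>2 * (d (i - 1))\<^sup>2\<close> is estimated with \<open>\<theta> (i - 1)\<close>, which also has \<open>u i\<close> as an
    end point, because the shift by one index turns that product into the one with \<open>d (i + 1)\<close>.\<close>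
  also have "\<dots> \<le> 1/4 * K * h * (\<Sum>i=1..?M. \<theta> i powr (n - 4) * ((d i)\<^sup>2 * (d (i - 1))\<^sup>2 + 2 * d i ^ 4)
      + \<theta> (i - 1) powr (n - 4) * ((d i)\<^sup>2 * (d (i - 1))\<^sup>2))"
  proof (intro mult_left_mono sum_mono)
    fix i
    let ?c = "(1 + Cosc cF) powr (n - 4) * ?U i powr (n - 4)"
    have "?c * ((d i)\<^sup>2 * (d (i - 1))\<^sup>2 + 2 * d i ^ 4) \<le>
        \<theta> i powr (n - 4) * ((d i)\<^sup>2 * (d (i - 1))\<^sup>2 + 2 * d i ^ 4)"
      using weight[OF \<theta>le(1)[of i] pos] by (intro mult_right_mono) auto
    moreover have "?c * ((d i)\<^sup>2 * (d (i - 1))\<^sup>2) \<le> \<theta> (i - 1) powr (n - 4) * ((d i)\<^sup>2 * (d (i - 1))\<^sup>2)"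
      using weight[of "i - 1" "?U i"] \<theta>le(2)[of "i - 1"] pos by (intro mult_right_mono) auto
    ultimately show "?c * (2 * (d i)\<^sup>2 * (d (i - 1))\<^sup>2 + 2 * (d i) ^ 4) \<le>
        \<theta> i powr (n - 4) * ((d i)\<^sup>2 * (d (i - 1))\<^sup>2 + 2 * d i ^ 4)
      + \<theta> (i - 1) powr (n - 4) * ((d i)\<^sup>2 * (d (i - 1))\<^sup>2)"
      by (simp add: algebra_simps)
  qed (use K assms(2) in auto)
  also have "\<dots> = S"
  proof -
    define g where "g i = \<theta> (i - 1) powr (n - 4) * ((d i)\<^sup>2 * (d (i - 1))\<^sup>2)" for i
    have "g (i + ?M) = g i" for i
      using per\<theta>[of "i - 1"] perd[of i] perd[of "i - 1"] by (simp add: g_def algebra_simps)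
    then have "(\<Sum>i=1..?M. g i) = (\<Sum>i=1..?M. g (i + 1))"
      using sum_shift_periodic[of ?M g] Lh_props(1)[OF assms(1-3)] by simp
    then have "(\<Sum>i=1..?M. \<theta> i powr (n - 4) * ((d i)\<^sup>2 * (d (i - 1))\<^sup>2 + 2 * d i ^ 4) + g i) =
      (\<Sum>i=1..?M. \<theta> i powr (n - 4) * ((d i)\<^sup>2 * (d (i - 1))\<^sup>2 + 2 * d i ^ 4) + g (i + 1))"
      by (simp only: sum.distrib)
    also have "\<dots> = (\<Sum>i=1..?M. \<theta> i powr (n - 4) * \<bar>d i\<bar>\<^sup>2 *
        (\<bar>d (i - 1)\<bar>\<^sup>2 + 2 * \<bar>d i\<bar>\<^sup>2 + \<bar>d (i + 1)\<bar>\<^sup>2))"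
      unfolding g_def by (intro sum.cong refl) (simp add: algebra_simps power2_eq_square power4_eq_xxxx)
    finally show ?thesis unfolding S_def g_def by simp
  qed
  finally have ineq: "K * ((1 + Cosc cF) powr (n - 4) / 2) * h * (\<Sum>i=1..?M.
      ?U i powr (n - 4) * (\<bar>d i\<bar>\<^sup>2 * \<bar>d (i - 1)\<bar>\<^sup>2 + \<bar>d i\<bar> ^ 4)) \<le> S" .
  show ?thesis
    unfolding Let_def dq K_def[symmetric]
    using \<sigma> A_Delta_eq_A_nabla eq[unfolded S_def \<theta>_def]
      ineq[unfolded S_def \<theta>_def]
    by (intro conjI exI[of _ \<sigma>] ballI) assumption+
qed

end
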